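(* Let $D$ be a fixed (time-independent) object, $c>0$, $\tau>0$. Let $(p^n,q^n,\bm{\chi}^n,\bm{\lambda}^n)_{n\ge0}$ be sufficiently smooth functions on $\Omega\setminus\overline{D}$ ($p^n,q^n$ scalar, $\bm\chi^n,\bm\lambda^n$ $\mathbb{R}^2$-valued), with $p^n=0$ on $\partial D$ and $p^n=0$, $\bm{\lambda}^n\cdot\mathbf n=0$ on $\partial\Omega$, satisfying for all $n\ge0$ the Crank--Nicolson scheme $$\begin{aligned} D_t^+p^n&=A_t^+q^n-aA_t^+p^n,\\ D_t^+q^n&=-bA_t^+p^n+c\nabla\cdot A_t^+\bm{\chi}^n,\\ D_t^+\bm{\chi}^n&=c\nabla A_t^+q^n-2\varGamma_1A_t^+\bm{\chi}^n+\varGamma_1A_t^+\bm{\lambda}^n,\\ D_t^+\bm{\lambda}^n&=-\widetilde{\varGamma}_1A_t^+\bm{\lambda}^n+\varGamma_2A_t^+\bm{\chi}^n.\end{aligned}$$ Then for all $n\ge 0$ $$D_t^+\mathcal{E}^n=-\mathcal{D}^{n+\frac12},$$ where $$\mathcal{E}^n=\tfrac12\Bigl(\|q^n\|^2+\|\bm{\chi}^n\|^2+\|p^n\|_b^2+\|\bm{\lambda}^n\|_{a^{-1}\varGamma_1}^2\Bigr),$$ $$\mathcal{D}^{n+\frac12}=\|A_t^+p^n\|_{ab}^2+\|A_t^+\bm{\chi}^n\|_{\varGamma_1+a^{-1}\varGamma_1^2}^2+\|A_t^+(\bm{\chi}^n-\bm{\lambda}^n)\|_{a^{-1}b}^2.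$$
   Context: $\Omega_{\rm phy}=(-a_1,a_1)\times(-a_2,a_2)$ and $\Omega=(-a_1-L_1,a_1+L_1)\times(-a_2-L_2,a_2+L_2)$ with $a_i,L_i>0$; $\mathbf n$ is the unit normal on $\partial\Omega$. The object $D$ is a smooth bounded open set with $\overline D\subset\Omega_{\rm phy}$. The damping profiles are $\xi_i=\xi_i(x_i)\ge 0$, $i=1,2$, with $\xi_i(x_i)=0$ for $|x_i|<a_i$ and $\xi_i(x_i)=\overline{\xi}_i\Big(\frac{|x_i|-a_i}{L_i}-\frac{1}{2\pi}\sin\frac{2\pi(|x_i|-a_i)}{L_i}\Big)$ for $a_i\le|x_i|\le a_i+L_i$, where $\overline\xi_i\ge0$ is a parameter. Set $\varGamma_1=\mathrm{diag}(\xi_1,\xi_2)$, $\varGamma_2=\mathrm{diag}(\xi_2-\xi_1,\xi_1-\xi_2)$, $\widetilde{\varGamma}_1=\varGamma_1+\varGamma_2$, $a=\xi_1+\xi_2$, $b=\xi_1\xi_2$. For a sequence $\phi^n$: $D_t^+\phi^n=(\phi^{n+1}-\phi^n)/\tau$, $A_t^+\phi^n=(\phi^{n+1}+\phi^n)/2$. $(\cdot,\cdot)$ and $\|\cdot\|$ are the $L^2(\Omega\setminus\overline{D})$ inner product and norm, and $\|u\|_\omega^2=(\omega u,u)$ for a nonnegative function or symmetric positive semidefinite matrix field $\omega$. Where $a=0$, the (bounded) quantities $a^{-1}\varGamma_1$, $a^{-1}\varGamma_1^2$ and $a^{-1}b$ are understood to be $0$. *)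

theory Defs
  imports "HOL-Analysis.Analysis"
begin

subsection \<open>Differential operators and smoothness on the plane\<close>

definition partial_deriv :: "2 \<Rightarrow> (real^2 \<Rightarrow> 'b::real_normed_vector) \<Rightarrow> real^2 \<Rightarrow> 'b" where
  "partial_deriv i f x = frechet_derivative f (at x) (axis i 1)"

definition grad :: "(real^2 \<Rightarrow> real) \<Rightarrow> real^2 \<Rightarrow> real^2" where
  "grad f x = (\<chi> i. partial_deriv i f x)"

definition divergence :: "(real^2 \<Rightarrow> real^2) \<Rightarrow> real^2 \<Rightarrow> real" where
  "divergence F x = (\<Sum>i\<in>UNIV. partial_deriv i F x $ i)"

text \<open>Membership in \<open>C\<^sup>1\<close> of the closure of an open set \<open>U\<close>: the function and its derivative
  extend continuously to the closure. Values outside the closure are irrelevant.\<close>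

definition C1_closure :: "(real^2) set \<Rightarrow> (real^2 \<Rightarrow> 'b::real_normed_vector) \<Rightarrow> bool" where
  "C1_closure U f \<longleftrightarrow>
     continuous_on (closure U) f \<and>
     (\<exists>f' :: real^2 \<Rightarrow> (real^2) \<Rightarrow>\<^sub>L 'b.
        continuous_on (closure U) f' \<and>
        (\<forall>x\<in>U. (f has_derivative blinfun_apply (f' x)) (at x)))"

primrec Ck_on :: "nat \<Rightarrow> (real^2) set \<Rightarrow> (real^2 \<Rightarrow> real) \<Rightarrow> bool" where
  "Ck_on 0 S f \<longleftrightarrow> continuous_on S f"
| "Ck_on (Suc k) S f \<longleftrightarrow>
     (\<forall>x\<in>S. f differentiable (at x)) \<and> (\<forall>i. Ck_on k S (partial_deriv i f))"

text \<open>An open set is smooth if near each boundary point it is the sublevel set of a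
  \<open>C\<^sup>\<infinity>\<close> function without critical points. The set need not be connected.\<close>

definition smooth_open_set :: "(real^2) set \<Rightarrow> bool" where
  "smooth_open_set D \<longleftrightarrow>
     open D \<and>
     (\<forall>z\<in>frontier D. \<exists>V \<rho>. open V \<and> z \<in> V \<and> (\<forall>k. Ck_on k V \<rho>) \<and>
        (\<forall>x\<in>V. grad \<rho> x \<noteq> 0) \<and> D \<inter> V = {x \<in> V. \<rho> x < 0})"

subsection \<open>Domain and boundary\<close>

text \<open>The pairs \<open>(a\<^sub>1, a\<^sub>2)\<close> and \<open>(L\<^sub>1, L\<^sub>2)\<close> are encoded as vectors.\<close>

definition Omega_phy :: "real^2 \<Rightarrow> (real^2) set" where
  "Omega_phy a = box (- a) a"

definition Omega :: "real^2 \<Rightarrow> real^2 \<Rightarrow> (real^2) set" where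
  "Omega a L = box (- (a + L)) (a + L)"

text \<open>The unit normal exists only on the open sides, so the four corners are removed;
  the value of \<open>outer_normal\<close> at a corner (or off the boundary) has no meaning.\<close>

definition Omega_sides :: "real^2 \<Rightarrow> real^2 \<Rightarrow> (real^2) set" where
  "Omega_sides a L = {x \<in> frontier (Omega a L). \<not> (\<forall>i. \<bar>x $ i\<bar> = a $ i + L $ i)}"

definition outer_normal :: "real^2 \<Rightarrow> real^2 \<Rightarrow> real^2 \<Rightarrow> real^2" where
  "outer_normal a L x =
     (if \<bar>x $ 1\<bar> = a $ 1 + L $ 1 then axis 1 (sgn (x $ 1)) else axis 2 (sgn (x $ 2)))"

subsection \<open>Damping profiles and coefficients\<close>

definition damping :: "real \<Rightarrow> real \<Rightarrow> real \<Rightarrow> real \<Rightarrow> real" where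
  "damping a L xb t =
     (if \<bar>t\<bar> < a then 0
      else xb * ((\<bar>t\<bar> - a) / L - 1 / (2 * pi) * sin (2 * pi * (\<bar>t\<bar> - a) / L)))"

text \<open>The vector \<open>(\<xi>\<^sub>1(x\<^sub>1), \<xi>\<^sub>2(x\<^sub>2))\<close>. The coefficients below are functions of this vector.\<close>

definition xi :: "real^2 \<Rightarrow> real^2 \<Rightarrow> real^2 \<Rightarrow> real^2 \<Rightarrow> real^2" where
  "xi a L xb x = (\<chi> i. damping (a $ i) (L $ i) (xb $ i) (x $ i))"

definition diag2 :: "real \<Rightarrow> real \<Rightarrow> real^2^2" where
  "diag2 u v = vector [vector [u, 0], vector [0, v]]"

definition Gamma1 :: "real^2 \<Rightarrow> real^2^2" where
  "Gamma1 w = diag2 (w $ 1) (w $ 2)"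

definition Gamma2 :: "real^2 \<Rightarrow> real^2^2" where
  "Gamma2 w = diag2 (w $ 2 - w $ 1) (w $ 1 - w $ 2)"

definition Gamma1_tilde :: "real^2 \<Rightarrow> real^2^2" where
  "Gamma1_tilde w = Gamma1 w + Gamma2 w"

definition acoef :: "real^2 \<Rightarrow> real" where
  "acoef w = w $ 1 + w $ 2"

definition bcoef :: "real^2 \<Rightarrow> real" where
  "bcoef w = w $ 1 * w $ 2"

subsection \<open>Discrete time operators\<close>

definition Dt :: "real \<Rightarrow> (nat \<Rightarrow> 'a::real_vector) \<Rightarrow> nat \<Rightarrow> 'a" where
  "Dt \<tau> \<phi> n = (\<phi> (n + 1) - \<phi> n) /\<^sub>R \<tau>"

definition At :: "(nat \<Rightarrow> 'a::real_vector) \<Rightarrow> nat \<Rightarrow> 'a" where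
  "At \<phi> n = (\<phi> (n + 1) + \<phi> n) /\<^sub>R 2"

subsection \<open>Inner product, norms, energy and dissipation\<close>

definition L2_inner :: "(real^2) set \<Rightarrow> (real^2 \<Rightarrow> 'b::euclidean_space) \<Rightarrow> (real^2 \<Rightarrow> 'b) \<Rightarrow> real" where
  "L2_inner U u v = (LINT x:U|lborel. u x \<bullet> v x)"

definition L2_norm :: "(real^2) set \<Rightarrow> (real^2 \<Rightarrow> 'b::euclidean_space) \<Rightarrow> real" where
  "L2_norm U u = sqrt (L2_inner U u u)"

text \<open>The squared weighted norms, for a scalar and for a matrix weight.\<close>

definition wnorm2 :: "(real^2) set \<Rightarrow> (real^2 \<Rightarrow> real) \<Rightarrow> (real^2 \<Rightarrow> 'b::euclidean_space) \<Rightarrow> real" where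
  "wnorm2 U \<omega> u = L2_inner U (\<lambda>x. \<omega> x *\<^sub>R u x) u"

definition mwnorm2 :: "(real^2) set \<Rightarrow> (real^2 \<Rightarrow> real^2^2) \<Rightarrow> (real^2 \<Rightarrow> real^2) \<Rightarrow> real" where
  "mwnorm2 U \<omega> u = L2_inner U (\<lambda>x. \<omega> x *v u x) u"

text \<open>Here \<open>w\<close> is the field of damping profiles. Where \<open>a = 0\<close>, the weights containing
  \<open>a\<^sup>-\<^sup>1\<close> vanish as required, since \<open>inverse 0 = 0\<close>.\<close>

definition energy ::
  "(real^2) set \<Rightarrow> (real^2 \<Rightarrow> real^2) \<Rightarrow>
   (real^2 \<Rightarrow> real) \<Rightarrow> (real^2 \<Rightarrow> real) \<Rightarrow> (real^2 \<Rightarrow> real^2) \<Rightarrow> (real^2 \<Rightarrow> real^2) \<Rightarrow> real" where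
  "energy U w p q chi lam =
     1 / 2 * ((L2_norm U q)\<^sup>2 + (L2_norm U chi)\<^sup>2 + wnorm2 U (\<lambda>x. bcoef (w x)) p
       + mwnorm2 U (\<lambda>x. inverse (acoef (w x)) *\<^sub>R Gamma1 (w x)) lam)"

definition dissipation ::
  "(real^2) set \<Rightarrow> (real^2 \<Rightarrow> real^2) \<Rightarrow>
   (nat \<Rightarrow> real^2 \<Rightarrow> real) \<Rightarrow> (nat \<Rightarrow> real^2 \<Rightarrow> real^2) \<Rightarrow> (nat \<Rightarrow> real^2 \<Rightarrow> real^2) \<Rightarrow> nat \<Rightarrow> real" where
  "dissipation U w p chi lam n =
     wnorm2 U (\<lambda>x. acoef (w x) * bcoef (w x)) (\<lambda>x. At (\<lambda>m. p m x) n)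
     + mwnorm2 U
         (\<lambda>x. Gamma1 (w x) + inverse (acoef (w x)) *\<^sub>R (Gamma1 (w x) ** Gamma1 (w x)))
         (\<lambda>x. At (\<lambda>m. chi m x) n)
     + wnorm2 U (\<lambda>x. inverse (acoef (w x)) * bcoef (w x))
         (\<lambda>x. At (\<lambda>m. chi m x - lam m x) n)"

end

theory Submission
  imports Defs
begin

text \<open>Testing the scheme with the averaged fields gives a pointwise identity: the discrete time
  derivative of the energy density plus the dissipation density is \<open>c\<close> times the divergence of
  \<open>q \<chi>\<close>, with \<open>q\<close> and \<open>\<chi>\<close> the averages. The first equation of the scheme and the condition
  \<open>p = 0\<close> force \<open>q = 0\<close> on the whole boundary, so the integral of this divergence vanishes by an
  argument on lines that uses no regularity of the boundary.\<close>

section \<open>Integrals of derivatives along lines\<close>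

lemma set_integrable_continuous_on_superset:
  fixes f :: "'a::euclidean_space \<Rightarrow> 'b::{banach, second_countable_topology}"
  assumes "compact K" "continuous_on K f" "S \<in> sets borel" "S \<subseteq> K"
  shows "set_integrable lborel S f"
  using borel_integrable_compact[OF assms(1,2)] assms(3,4)
  by (auto simp: set_integrable_def[symmetric] intro: set_integrable_subset)

text \<open>A connected set of reals is convex, and an open convex set is the interior of its
  closure. So \<open>C\<close> is recovered from \<open>closure C\<close>, which is a compact
  interval.\<close>

lemma open_connected_compact_closure_real:
  fixes C :: "real set"
  assumes "open C" "connected C" "compact (closure C)" "C \<noteq> {}"
  obtains a b where "a \<le> b" "C = {a<..<b}" "closure C = {a..b}"
proof -
  have "connected (closure C)"
    using assms(2) by (rule connected_imp_connected_closure)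
  then obtain a b where ab: "closure C = {a..b}"
    using assms(3) connected_compact_interval_1[of "closure C"] by auto
  have "convex C"
    using assms(2) by (simp add: connected_convex_1)
  then have "C = interior (closure C)"
    using assms(1) by (simp add: convex_interior_closure interior_open)
  then show ?thesis
    using that[of a b] ab assms(4) by auto
qed

text \<open>The set \<open>V\<close> may have infinitely many components and a boundary of positive measure; the
  integral over each component vanishes by the fundamental theorem of calculus.\<close>

lemma integral_deriv_open_eq_0:
  fixes f g :: "real \<Rightarrow> real"
  assumes "open V" "compact K" "V \<subseteq> K"
    and f: "continuous_on K f" "\<And>t. t \<in> K - V \<Longrightarrow> f t = 0"
    and g: "continuous_on K g"
    and deriv: "\<And>t. t \<in> V \<Longrightarrow> (f has_real_derivative g t) (at t)"
  shows "(LINT t:V|lborel. g t) = 0"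
proof (cases "V = {}")
  case False
  let ?\<C> = "components V"
  have openC: "open C" if "C \<in> ?\<C>" for C
    using that \<open>open V\<close> open_components by blast
  have "countable ?\<C>"
    by (rule countable_disjoint_open_subsets) (auto simp: openC pairwise_disjoint_components
        disjnt_def pairwise_def dest: components_nonoverlap)
  moreover have "?\<C> \<noteq> {}"
    using False by simp
  ultimately have range: "range (from_nat_into ?\<C>) = ?\<C>"
    by (rule range_from_nat_into[rotated])
  have integrable: "set_integrable lborel S g" if "S \<in> sets borel" "S \<subseteq> V" for S
    using that assms by (intro set_integrable_continuous_on_superset[of K]) auto
  have zero: "(LINT t:C|lborel. g t) = 0" if C: "C \<in> ?\<C>" for C
  proof -
    have "C \<subseteq> V"
      using C in_components_subset by blast
    have "closure C \<subseteq> K"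
      using \<open>C \<subseteq> V\<close> \<open>V \<subseteq> K\<close> \<open>compact K\<close> by (intro closure_minimal compact_imp_closed) auto
    moreover from this have "compact (closure C)"
      using \<open>compact K\<close> by (metis closed_closure compact_Int_closed inf.absorb2)
    ultimately obtain a b where ab: "a \<le> b" "C = {a<..<b}" "closure C = {a..b}" "{a..b} \<subseteq> K"
      using open_connected_compact_closure_real[of C] openC[OF C] in_components_connected[OF C]
        in_components_nonempty[OF C] by metis
    \<comment> \<open>The end points of a component lie on the frontier of the open set
      \<open>V\<close>, hence outside \<open>V\<close> but still in \<open>K\<close>, which is where
      \<open>f\<close> is known to vanish.\<close>
    have "frontier C \<subseteq> frontier V"
      using C by (rule frontier_of_components_subset)
    moreover have "frontier C = {a, b}"
      using ab openC[OF C] in_components_nonempty[OF C] by (auto simp: frontier_def interior_open)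
    ultimately have "a \<notin> V" "b \<notin> V"
      using \<open>open V\<close> by (auto simp: frontier_def interior_open)
    then have "f a = 0" "f b = 0"
      using f(2) ab by auto
    \<comment> \<open>The derivative is given only inside \<open>C\<close>, hence the interior form
      of the fundamental theorem; continuity of \<open>f\<close> on \<open>K\<close> covers the end
      points.\<close>
    moreover have "(g has_integral f b - f a) {a..b}"
      using ab f(1) deriv \<open>C \<subseteq> V\<close>
      by (intro fundamental_theorem_of_calculus_interior)
        (auto intro: continuous_on_subset simp: has_real_derivative_iff_has_vector_derivative[symmetric])
    ultimately have "integral C g = 0"
      using ab by (auto simp: has_integral_Icc_iff_Ioo)
    then show ?thesis
      using integrable[of C] \<open>C \<subseteq> V\<close> ab by (simp add: set_borel_integral_eq_integral(2))
  qed
  \<comment> \<open>\<open>from_nat_into\<close> repeats values if there are only finitely many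
    components, so unions and sums run over image sets instead of indices. The sets
    \<open>A n\<close> increase to \<open>V\<close>, and continuity of the integral along them
    passes from finitely many components to all.\<close>
  define A where "A n = \<Union>(from_nat_into ?\<C> ` {..<n})" for n
  have sub: "from_nat_into ?\<C> ` {..<n} \<subseteq> ?\<C>" for n
    using range by blast
  have UnA: "(\<Union>n. A n) = V"
  proof -
    have "(\<Union>n. A n) = \<Union>(range (from_nat_into ?\<C>))"
      unfolding A_def by blast
    then show ?thesis
      using range Union_components by metis
  qed
  have openA: "open (A n)" for n
    using sub openC unfolding A_def by blast
  have "incseq A"
    unfolding A_def by (intro monoI Union_mono image_mono) auto
  have "(\<lambda>n. LINT t:A n|lborel. g t) \<longlonglongrightarrow> (LINT t:(\<Union>n. A n)|lborel. g t)"
    using openA UnA \<open>open V\<close> integrable \<open>incseq A\<close> by (intro set_integral_cont_up) auto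
  moreover have "(LINT t:A n|lborel. g t) = 0" for n
  proof -
    let ?I = "from_nat_into ?\<C> ` {..<n}"
    have "(LINT t:(\<Union>C\<in>?I. C)|lborel. g t) = (\<Sum>C\<in>?I. LINT t:C|lborel. g t)"
    proof (rule set_integral_finite_Union)
      show "disjoint_family_on (\<lambda>C. C) ?I"
        unfolding disjoint_family_on_def using sub[of n] by (meson components_nonoverlap subsetD)
    next
      fix C assume "C \<in> ?I"
      then have "C \<in> ?\<C>"
        using sub[of n] by (rule subsetD[rotated])
      then show "set_integrable lborel C g" "C \<in> sets lborel"
        using openC[of C] in_components_subset[of C V] integrable[of C] by auto
    qed simp
    also have "\<dots> = 0"
      using zero sub[of n] by (intro sum.neutral ballI) (meson subsetD)
    finally show ?thesis
      by (simp add: A_def)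
  qed
  ultimately show ?thesis
    using UnA by (simp add: LIMSEQ_const_iff)
qed (simp add: set_lebesgue_integral_def)

text \<open>The integrals of \<open>g\<close> along all lines parallel to \<open>e\<close> vanish. Averaging them over the slab
  \<open>0 \<le> x \<bullet> e \<le> 1\<close> of starting points recovers the integral of \<open>g\<close> over \<open>U\<close>, which avoids
  splitting Lebesgue measure into a product.\<close>

lemma integral_directional_deriv_eq_0:
  fixes f g :: "'a::euclidean_space \<Rightarrow> real"
  assumes U: "open U" "bounded U" and e: "e \<in> Basis"
    and f: "continuous_on (closure U) f" "\<And>x. x \<in> frontier U \<Longrightarrow> f x = 0"
    and g: "continuous_on (closure U) g"
    and deriv: "\<And>x. x \<in> U \<Longrightarrow> ((\<lambda>t. f (x + t *\<^sub>R e)) has_real_derivative g x) (at 0)"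
  shows "(LINT x:U|lborel. g x) = 0"
proof -
  \<comment> \<open>Extension of \<open>g\<close> by zero, so that whole lines and the whole space
    can serve as domains of integration.\<close>
  define G where "G x = indicator U x *\<^sub>R g x" for x
  have cpt: "compact (closure U)"
    using U by (simp add: compact_closure)
  have [measurable]: "G \<in> borel_measurable borel"
    using borel_measurable_integrable[OF set_integrable_continuous_on_superset[OF cpt g, of U,
      unfolded set_integrable_def]] U closure_subset[of U]
    by (simp add: G_def[abs_def])
  have ne: "norm e = 1" "e \<bullet> e = 1"
    using e by auto
  obtain R where R: "\<And>x. x \<in> U \<Longrightarrow> norm x \<le> R"
    using \<open>bounded U\<close> bounded_iff by blast
  have "bounded (g ` closure U)"
    using cpt g compact_continuous_image compact_imp_bounded by blast
  then obtain B where B: "\<And>x. x \<in> U \<Longrightarrow> \<bar>g x\<bar> \<le> B"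
    using closure_subset unfolding bounded_iff by (metis image_eqI real_norm_def subsetD)
  \<comment> \<open>The absolute value of \<open>B\<close> is taken because \<open>B\<close> may be
    negative when \<open>U\<close> is empty.\<close>
  have B': "\<bar>G x\<bar> \<le> \<bar>B\<bar>" for x
    using B[of x] by (auto simp: G_def indicator_def)
  have line: "(LINT t|lborel. G (x + t *\<^sub>R e)) = 0" for x
  proof -
    \<comment> \<open>\<open>K\<close> can be larger than \<open>closure V\<close>, since the line
      may run along the frontier of \<open>U\<close>. Every parameter in \<open>K - V\<close> gives
      a frontier point, where \<open>f\<close> vanishes.\<close>
    define V where "V = (\<lambda>t. x + t *\<^sub>R e) -` U"
    define K where "K = (\<lambda>t. x + t *\<^sub>R e) -` closure U"
    have cont: "continuous_on S (\<lambda>t. x + t *\<^sub>R e)" for S :: "real set"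
      by (intro continuous_intros)
    have "bounded K"
    proof -
      obtain M where M: "\<And>y. y \<in> closure U \<Longrightarrow> norm y \<le> M"
        using cpt compact_imp_bounded bounded_iff by metis
      have "\<bar>t\<bar> \<le> M + norm x" if "t \<in> K" for t
      proof -
        have "\<bar>t\<bar> = norm ((x + t *\<^sub>R e) - x)"
          using ne by simp
        also have "\<dots> \<le> norm (x + t *\<^sub>R e) + norm x"
          by (rule norm_triangle_ineq4)
        also have "\<dots> \<le> M + norm x"
          using M that by (simp add: K_def)
        finally show ?thesis .
      qed
      then show ?thesis
        by (auto simp: bounded_iff)
    qed
    moreover have "closed K"
      unfolding K_def by (intro continuous_closed_vimage) (auto intro!: continuous_intros)
    ultimately have "compact K"
      by (simp add: compact_eq_bounded_closed)
    have "(LINT t:V|lborel. g (x + t *\<^sub>R e)) = 0"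
    proof (rule integral_deriv_open_eq_0[of V K "\<lambda>t. f (x + t *\<^sub>R e)"])
      show "open V"
        unfolding V_def using U by (intro continuous_open_vimage) (auto intro!: continuous_intros)
      show "V \<subseteq> K"
        using closure_subset by (auto simp: V_def K_def)
      show "continuous_on K (\<lambda>t. f (x + t *\<^sub>R e))"
        by (rule continuous_on_compose2[OF f(1) cont]) (auto simp: K_def)
      show "continuous_on K (\<lambda>t. g (x + t *\<^sub>R e))"
        by (rule continuous_on_compose2[OF g cont]) (auto simp: K_def)
      show "f (x + t *\<^sub>R e) = 0" if "t \<in> K - V" for t
        using that U by (intro f(2)) (auto simp: K_def V_def frontier_def interior_open)
      show "((\<lambda>t. f (x + t *\<^sub>R e)) has_real_derivative g (x + t *\<^sub>R e)) (at t)" if "t \<in> V" for t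
      proof -
        have "((\<lambda>s. f (x + t *\<^sub>R e + s *\<^sub>R e)) has_real_derivative g (x + t *\<^sub>R e)) (at 0)"
          using that by (intro deriv) (simp add: V_def)
        then show ?thesis
          using DERIV_shift[of "\<lambda>t. f (x + t *\<^sub>R e)" "g (x + t *\<^sub>R e)" 0 t]
          by (simp add: algebra_simps)
      qed
    qed fact
    moreover have "indicator V t *\<^sub>R g (x + t *\<^sub>R e) = G (x + t *\<^sub>R e)" for t
      by (simp add: G_def V_def indicator_def)
    ultimately show ?thesis
      by (simp add: set_lebesgue_integral_def)
  qed
  define S where "S = (indicator {0..1} :: real \<Rightarrow> real)"
  have [measurable]: "S \<in> borel_measurable borel"
    by (simp add: S_def)
  \<comment> \<open>Both integrands below vanish outside this box. If \<open>x \<bullet> e\<close>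
    is in \<open>{0..1}\<close> and the translated point is in \<open>U\<close>, then
    \<open>\<bar>x \<bullet> e + t\<bar> \<le> R\<close> gives
    \<open>\<bar>t\<bar> \<le> R + 1\<close>, and the triangle inequality gives
    \<open>norm x \<le> R + (R + 1)\<close>. The second integrand has \<open>x\<close> itself in
    \<open>U\<close>, so the same bounds hold.\<close>
  have finite_box: "emeasure (lborel \<Otimes>\<^sub>M lborel) (({-R-1..R+1}::real set) \<times> (cball 0 (2*R+1) :: 'a set)) < \<infinity>"
    unfolding lborel_prod by (intro emeasure_bounded_finite bounded_Times) auto
  have "integrable (lborel \<Otimes>\<^sub>M lborel) (\<lambda>(t::real, x). S (x \<bullet> e) * G (x + t *\<^sub>R e))"
  proof (rule integrableI_bounded_set[OF _ _ finite_box, where B = "\<bar>B\<bar>"])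
    have "norm x \<le> 2*R+1 \<and> \<bar>t\<bar> \<le> R+1" if "x \<bullet> e \<in> {0..1}" "x + t *\<^sub>R e \<in> U" for x t
    proof -
      have "\<bar>(x + t *\<^sub>R e) \<bullet> e\<bar> \<le> norm (x + t *\<^sub>R e)"
        using e by (rule Basis_le_norm)
      then have "\<bar>x \<bullet> e + t\<bar> \<le> R"
        using R[OF that(2)] ne by (simp add: inner_add_left)
      then have "\<bar>t\<bar> \<le> R + 1"
        using that(1) by auto
      moreover have "norm x \<le> norm (x + t *\<^sub>R e) + norm (t *\<^sub>R e)"
        using norm_triangle_ineq4[of "x + t *\<^sub>R e" "t *\<^sub>R e"] by simp
      ultimately show ?thesis
        using R[OF that(2)] ne by simp
    qed
    then show "AE z in lborel \<Otimes>\<^sub>M lborel. z \<notin> {-R-1..R+1} \<times> cball 0 (2*R+1) \<longrightarrow>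
        (case z of (t, x) \<Rightarrow> S (x \<bullet> e) * G (x + t *\<^sub>R e)) = 0"
      by (intro AE_I2) (fastforce simp: S_def G_def indicator_def split: if_splits)
    show "AE z in lborel \<Otimes>\<^sub>M lborel. z \<in> {-R-1..R+1} \<times> cball 0 (2*R+1) \<longrightarrow>
        norm (case z of (t, x) \<Rightarrow> S (x \<bullet> e) * G (x + t *\<^sub>R e)) \<le> \<bar>B\<bar>"
      using B' by (intro AE_I2) (auto simp: S_def indicator_def)
  qed measurable
  note F1 = lborel_pair.Fubini_integral[OF this]
  have "integrable (lborel \<Otimes>\<^sub>M lborel) (\<lambda>(t::real, x). S (x \<bullet> e - t) * G x)"
  proof (rule integrableI_bounded_set[OF _ _ finite_box, where B = "\<bar>B\<bar>"])
    have "norm x \<le> 2*R+1 \<and> \<bar>t\<bar> \<le> R+1" if "x \<bullet> e - t \<in> {0..1}" "x \<in> U" for x t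
      using Basis_le_norm[OF e, of x] R[OF that(2)] that(1) norm_ge_zero[of x]
      unfolding atLeastAtMost_iff by linarith
    then show "AE z in lborel \<Otimes>\<^sub>M lborel. z \<notin> {-R-1..R+1} \<times> cball 0 (2*R+1) \<longrightarrow>
        (case z of (t, x) \<Rightarrow> S (x \<bullet> e - t) * G x) = 0"
      by (intro AE_I2) (fastforce simp: S_def G_def indicator_def split: if_splits)
    show "AE z in lborel \<Otimes>\<^sub>M lborel. z \<in> {-R-1..R+1} \<times> cball 0 (2*R+1) \<longrightarrow>
        norm (case z of (t, x) \<Rightarrow> S (x \<bullet> e - t) * G x) \<le> \<bar>B\<bar>"
      using B' by (intro AE_I2) (auto simp: S_def indicator_def)
  qed measurable
  note F2 = lborel_pair.Fubini_integral[OF this]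
  have slab: "(LINT t|lborel. S (r - t)) = 1" for r
  proof -
    have "S (r - t) = indicator {r-1..r} t" for t
      by (auto simp: S_def indicator_def)
    then show ?thesis
      by simp
  qed
  \<comment> \<open>Translation by \<open>t *\<^sub>R e\<close> preserves Lebesgue measure and,
    since \<open>e \<bullet> e = 1\<close>, raises \<open>x \<bullet> e\<close> by exactly
    \<open>t\<close>.\<close>
  have shift: "(LINT x|lborel. S (x \<bullet> e) * G (x + t *\<^sub>R e)) = (LINT x|lborel. S (x \<bullet> e - t) * G x)"
    for t
  proof -
    have "(LINT x|lborel. S (x \<bullet> e - t) * G x) =
        (LINT x|distr lborel borel ((+) (t *\<^sub>R e)). S (x \<bullet> e - t) * G x)"
      by (simp add: lborel_distr_plus)
    also have "\<dots> = (LINT x|lborel. S (x \<bullet> e) * G (x + t *\<^sub>R e))"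
      by (subst integral_distr) (auto simp: inner_add_left ne add.commute)
    finally show ?thesis ..
  qed
  \<comment> \<open>The factor 1 is written as the integral of \<open>S (x \<bullet> e - t)\<close>
    over \<open>t\<close>. Exchanging the integrals, translating, and exchanging back leaves the
    line integral innermost, where \<open>S (x \<bullet> e)\<close> is a constant factor.\<close>
  have "(LINT x:U|lborel. g x) = (LINT x|lborel. (LINT t|lborel. S (x \<bullet> e - t) * G x))"
    by (simp add: slab set_lebesgue_integral_def G_def)
  also have "\<dots> = (LINT t|lborel. (LINT x|lborel. S (x \<bullet> e) * G (x + t *\<^sub>R e)))"
    using F2 by (simp add: shift)
  also have "\<dots> = (LINT x|lborel. (LINT t|lborel. S (x \<bullet> e) * G (x + t *\<^sub>R e)))"
    using F1 by simp
  also have "\<dots> = 0"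
    by (simp add: line)
  finally show ?thesis .
qed

section \<open>The divergence theorem for a product with zero boundary values\<close>

text \<open>Identifies the partial derivatives inside \<open>U\<close> with evaluations of a field
  \<open>f'\<close> that is continuous up to the closure; boundedness and integrability arguments
  use \<open>f'\<close>.\<close>

lemma C1_closureE:
  assumes "C1_closure U f"
  obtains f' where "continuous_on (closure U) f" "continuous_on (closure U) f'"
    "\<And>x. x \<in> U \<Longrightarrow> (f has_derivative blinfun_apply (f' x)) (at x)"
    "\<And>i x. x \<in> U \<Longrightarrow> partial_deriv i f x = blinfun_apply (f' x) (axis i 1)"
proof -
  obtain f' where f': "continuous_on (closure U) f" "continuous_on (closure U) f'"
    "\<And>x. x \<in> U \<Longrightarrow> (f has_derivative blinfun_apply (f' x)) (at x)"
    using assms unfolding C1_closure_def by blast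
  moreover have "partial_deriv i f x = blinfun_apply (f' x) (axis i 1)" if "x \<in> U" for i x
    using frechet_derivative_at[OF f'(3)[OF that]] by (simp add: partial_deriv_def)
  ultimately show thesis
    by (rule that)
qed

lemma C1_closure_At:
  assumes "\<And>n. C1_closure U (f n)"
  shows "C1_closure U (\<lambda>x. At (\<lambda>m. f m x) n)"
proof -
  obtain g where g: "continuous_on (closure U) (f n)" "continuous_on (closure U) g"
    "\<And>x. x \<in> U \<Longrightarrow> (f n has_derivative blinfun_apply (g x)) (at x)"
    using C1_closureE[OF assms] by metis
  obtain h where h: "continuous_on (closure U) (f (n + 1))" "continuous_on (closure U) h"
    "\<And>x. x \<in> U \<Longrightarrow> (f (n + 1) has_derivative blinfun_apply (h x)) (at x)"
    using C1_closureE[OF assms] by metis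
  show ?thesis
    unfolding C1_closure_def
  proof (intro conjI exI[of _ "\<lambda>x. (h x + g x) /\<^sub>R 2"] ballI)
    fix x assume "x \<in> U"
    then have "((\<lambda>x. (f (n + 1) x + f n x) /\<^sub>R 2) has_derivative
        (\<lambda>y. (h x y + g x y) /\<^sub>R 2)) (at x)"
      using g(3) h(3) by (intro derivative_intros)
    then show "((\<lambda>x. At (\<lambda>m. f m x) n) has_derivative ((h x + g x) /\<^sub>R 2)) (at x)"
      by (simp add: At_def blinfun.bilinear_simps[abs_def])
  qed (use g h in \<open>auto simp: At_def intro!: continuous_intros\<close>)
qed

lemma has_derivative_directional:
  fixes f :: "'a::real_normed_vector \<Rightarrow> real"
  assumes "(f has_derivative f') (at x)"
  shows "((\<lambda>t. f (x + t *\<^sub>R e)) has_real_derivative f' e) (at 0)"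
proof -
  interpret bounded_linear f'
    using assms by (rule has_derivative_bounded_linear)
  have "((\<lambda>t::real. x + t *\<^sub>R e) has_derivative (\<lambda>t. t *\<^sub>R e)) (at 0)"
    by (auto intro!: derivative_eq_intros)
  then have "((\<lambda>t::real. f (x + t *\<^sub>R e)) has_derivative (\<lambda>t. f' (t *\<^sub>R e))) (at 0)"
    using assms has_derivative_compose[of "\<lambda>t::real. x + t *\<^sub>R e" _ 0 UNIV f f'] by simp
  then show ?thesis
    by (simp add: has_field_derivative_def scaleR mult_commute_abs)
qed

text \<open>The integrand is the divergence of the product of \<open>q\<close> and \<open>v\<close>.
  It splits into the derivatives of \<open>q x * v x $ i\<close> along the two axes, and each of
  these products vanishes on the frontier together with \<open>q\<close>.\<close>

lemma
  assumes U: "open U" "bounded U"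
    and q: "C1_closure U q" "\<And>x. x \<in> frontier U \<Longrightarrow> q x = 0"
    and v: "C1_closure U v"
  shows divergence_product_integrable:
      "set_integrable lborel U (\<lambda>x. q x * divergence v x + grad q x \<bullet> v x)"
    and integral_divergence_product_eq_0:
      "(LINT x:U|lborel. q x * divergence v x + grad q x \<bullet> v x) = 0"
proof -
  obtain q' where q': "continuous_on (closure U) q" "continuous_on (closure U) q'"
    "\<And>x. x \<in> U \<Longrightarrow> (q has_derivative blinfun_apply (q' x)) (at x)"
    "\<And>i x. x \<in> U \<Longrightarrow> partial_deriv i q x = blinfun_apply (q' x) (axis i 1)"
    using C1_closureE[OF q(1)] by metis
  obtain v' where v': "continuous_on (closure U) v" "continuous_on (closure U) v'"
    "\<And>x. x \<in> U \<Longrightarrow> (v has_derivative blinfun_apply (v' x)) (at x)"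
    "\<And>i x. x \<in> U \<Longrightarrow> partial_deriv i v x = blinfun_apply (v' x) (axis i 1)"
    using C1_closureE[OF v] by metis
  \<comment> \<open>The product rule along axis \<open>i\<close>, written with \<open>q'\<close> and
    \<open>v'\<close> to obtain continuity on the closure; \<open>eq\<close> below links it to
    \<open>divergence\<close> and \<open>grad\<close> inside \<open>U\<close>.\<close>
  define h where "h i x = q x * (v' x (axis i 1) $ i) + q' x (axis i 1) * v x $ i" for i :: 2 and x
  have cont: "continuous_on (closure U) (h i)" for i
    unfolding h_def[abs_def] using q' v' by (intro continuous_intros)
  have zero: "(LINT x:U|lborel. h i x) = 0" for i
  proof (rule integral_directional_deriv_eq_0[OF U, of "axis i 1" "\<lambda>x. q x * v x $ i"])
    show "(axis i 1 :: real^2) \<in> Basis"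
      by (auto simp: Basis_vec_def)
    show "continuous_on (closure U) (\<lambda>x. q x * v x $ i)"
      using q' v' by (intro continuous_intros)
    show "((\<lambda>t. q (x + t *\<^sub>R axis i 1) * v (x + t *\<^sub>R axis i 1) $ i) has_real_derivative h i x) (at 0)"
      if "x \<in> U" for x
    proof -
      have "((\<lambda>x. v x $ i) has_derivative (\<lambda>y. v' x y $ i)) (at x)"
        using v'(3)[OF that] by (rule bounded_linear.has_derivative[OF bounded_linear_vec_nth])
      then have "((\<lambda>x. q x * v x $ i) has_derivative (\<lambda>y. q x * v' x y $ i + q' x y * v x $ i)) (at x)"
        using q'(3)[OF that] has_derivative_mult by blast
      then show ?thesis
        unfolding h_def by (rule has_derivative_directional)
    qed
  qed (use q(2) cont in auto)
  have integrable: "set_integrable lborel U (h i)" for i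
    using cont U closure_subset
    by (intro set_integrable_continuous_on_superset[of "closure U"]) (auto simp: compact_closure)
  have eq: "q x * divergence v x + grad q x \<bullet> v x = h 1 x + h 2 x" if "x \<in> U" for x
    using that by (simp add: h_def divergence_def grad_def inner_vec_def sum_2 q' v' algebra_simps)
  have "set_integrable lborel U (\<lambda>x. h 1 x + h 2 x)"
    using integrable by (intro set_integral_add)
  then show "set_integrable lborel U (\<lambda>x. q x * divergence v x + grad q x \<bullet> v x)"
    using eq by (subst set_integrable_cong[OF refl refl]) auto
  have "(LINT x:U|lborel. q x * divergence v x + grad q x \<bullet> v x) = (LINT x:U|lborel. h 1 x + h 2 x)"
    using U eq by (intro set_lebesgue_integral_cong) auto
  also have "\<dots> = 0"
    using integrable by (simp add: zero)
  finally show "(LINT x:U|lborel. q x * divergence v x + grad q x \<bullet> v x) = 0" .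
qed

section \<open>Damping profiles, coefficient matrices and their ratios\<close>

text \<open>With \<open>y = 2 * pi * (\<bar>t\<bar> - a) / L\<close> the bracket in the outer branch
  is \<open>(y - sin y) / (2 * pi)\<close>, and \<open>sin y \<le> y\<close> for
  \<open>y \<ge> 0\<close>.\<close>

lemma damping_nonneg:
  assumes "L > 0" "xb \<ge> 0"
  shows "damping a L xb t \<ge> 0"
proof (cases "\<bar>t\<bar> < a")
  case False
  define y where "y = 2 * pi * (\<bar>t\<bar> - a) / L"
  have "y \<ge> 0"
    using False assms by (simp add: y_def)
  then have "sin y \<le> y"
    by (rule sin_x_le_x)
  moreover have "(\<bar>t\<bar> - a) / L = y / (2 * pi)"
    by (simp add: y_def)
  ultimately have "0 \<le> (\<bar>t\<bar> - a) / L - 1 / (2 * pi) * sin y"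
    by (simp add: divide_right_mono)
  then have "0 \<le> xb * ((\<bar>t\<bar> - a) / L - 1 / (2 * pi) * sin y)"
    using assms by (intro mult_nonneg_nonneg)
  then show ?thesis
    using False unfolding damping_def y_def by (simp only: if_False)
qed (simp add: damping_def)

text \<open>The outer branch vanishes at \<open>\<bar>t\<bar> = a\<close>, so replacing
  \<open>\<bar>t\<bar> - a\<close> by its positive part merges both branches into one continuous
  formula.\<close>

lemma continuous_damping: "continuous_on S (damping a L xb)"
proof -
  define m where "m t = max (\<bar>t\<bar> - a) 0" for t
  have "damping a L xb t = xb * (m t * inverse L - 1 / (2 * pi) * sin (2 * pi * m t * inverse L))" for t
  proof (cases "\<bar>t\<bar> < a")
    case True
    then have "m t = 0"
      by (simp add: m_def)
    then show ?thesis
      using True by (simp add: damping_def)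
  next
    case False
    then have "m t = \<bar>t\<bar> - a"
      by (simp add: m_def)
    then show ?thesis
      unfolding damping_def divide_inverse using False by (simp only: if_False)
  qed
  moreover have "continuous_on S m"
    unfolding m_def by (intro continuous_intros)
  ultimately show ?thesis
    by (auto intro!: continuous_intros)
qed

lemma continuous_xi: "continuous_on S (xi a L xb)"
  unfolding xi_def[abs_def]
  by (intro continuous_on_vec_lambda continuous_on_compose2[OF continuous_damping[of UNIV]]
      continuous_intros) auto

lemma diag2_mult_vec: "diag2 u v *v y = vector [u * y $ 1, v * y $ 2]"
  by (simp add: diag2_def matrix_vector_mult_def vec_eq_iff forall_2 sum_2)

lemma diag2_add: "diag2 u v + diag2 u' v' = diag2 (u + u') (v + v')"
  and diag2_scaleR: "k *\<^sub>R diag2 u v = diag2 (k * u) (k * v)"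
  and diag2_mult: "diag2 u v ** diag2 u' v' = diag2 (u * u') (v * v')"
  by (simp_all add: diag2_def matrix_matrix_mult_def vec_eq_iff forall_2 sum_2)

lemmas diag2_simps = diag2_mult_vec diag2_add diag2_scaleR diag2_mult
  Gamma1_def Gamma2_def Gamma1_tilde_def

lemma inner_vec2: "x \<bullet> y = x $ 1 * y $ 1 + x $ 2 * y $ 2" for x y :: "real^2"
  by (simp add: inner_vec_def sum_2)

text \<open>The relations \<open>r\<^sub>i a = w\<^sub>i\<close> and \<open>r\<^sub>1 w\<^sub>2 = r\<^sub>2 w\<^sub>1\<close> for \<open>r\<^sub>i = w\<^sub>i / a\<close> remain true where
  \<open>a = 0\<close>, so all pointwise identities can be derived from them without a case distinction.\<close>

definition ratio :: "real^2 \<Rightarrow> 2 \<Rightarrow> real" where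
  "ratio w i = inverse (acoef w) * w $ i"

text \<open>Where the sum is zero, nonnegativity forces both entries of \<open>w\<close> to be zero,
  so both sides vanish.\<close>

lemma ratio_mult_acoef:
  assumes "\<And>i. w $ i \<ge> 0"
  shows "ratio w i * (w $ 1 + w $ 2) = w $ i"
proof (cases "w $ 1 + w $ 2 = 0")
  case True
  then have "w $ 1 = 0 \<and> w $ 2 = 0"
    using assms[of 1] assms[of 2] by linarith
  then have "w $ i = 0"
    using exhaust_2[of i] by auto
  then show ?thesis
    using True by simp
qed (simp add: ratio_def acoef_def field_simps)

lemma ratio_swap: "ratio w 1 * w $ 2 = ratio w 2 * w $ 1"
  by (simp add: ratio_def)

text \<open>The ratios are discontinuous at \<open>w = 0\<close>, so integrability of terms
  containing them rests on this bound instead of on continuity.\<close>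

lemma abs_ratio_le_1:
  assumes "\<And>i. w $ i \<ge> 0"
  shows "\<bar>ratio w i\<bar> \<le> 1"
proof -
  have "0 \<le> ratio w i"
    using assms[of i] assms[of 1] assms[of 2] by (simp add: ratio_def acoef_def)
  moreover have "ratio w i \<le> 1"
  proof (cases "w $ 1 + w $ 2 = 0")
    case False
    then have "0 < w $ 1 + w $ 2"
      using assms[of 1] assms[of 2] by linarith
    moreover have "w $ i \<le> w $ 1 + w $ 2"
      using assms[of 1] assms[of 2] exhaust_2[of i] by auto
    ultimately show ?thesis
      by (simp add: ratio_def acoef_def inverse_eq_divide)
  qed (simp add: ratio_def acoef_def)
  ultimately show ?thesis
    by simp
qed

section \<open>The pointwise energy balance\<close>

definition energy_density ::
  "real^2 \<Rightarrow> real \<Rightarrow> real \<Rightarrow> real^2 \<Rightarrow> real^2 \<Rightarrow> real" where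
  "energy_density w p q u v =
     (q\<^sup>2 + u \<bullet> u + bcoef w * p\<^sup>2 + (ratio w 1 * (v $ 1)\<^sup>2 + ratio w 2 * (v $ 2)\<^sup>2)) / 2"

text \<open>\<open>ratio w i * w $ i\<close> are the diagonal entries of
  \<open>a^-1 Gamma1^2\<close>. The weight \<open>a^-1 b\<close> is written as
  \<open>ratio w 1 * w $ 2\<close>, which by \<open>ratio_swap\<close> is symmetric in the two
  indices.\<close>

definition dissipation_density :: "real^2 \<Rightarrow> real \<Rightarrow> real^2 \<Rightarrow> real^2 \<Rightarrow> real" where
  "dissipation_density w p u v =
     acoef w * bcoef w * p\<^sup>2
     + (w $ 1 * (u $ 1)\<^sup>2 + w $ 2 * (u $ 2)\<^sup>2
        + ratio w 1 * (w $ 1 * (u $ 1)\<^sup>2) + ratio w 2 * (w $ 2 * (u $ 2)\<^sup>2))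
     + ratio w 1 * (w $ 2 * ((u - v) \<bullet> (u - v)))"

text \<open>The four equations are multiplied by \<open>bcoef w * p\<close>, \<open>q\<close>,
  \<open>u\<close> and the \<open>ratio\<close>-weighted \<open>v\<close>. The products of
  \<open>p\<close> and \<open>q\<close> cancel. Writing one copy of \<open>w $ i\<close> as
  \<open>ratio w i * (w $ 1 + w $ 2)\<close> completes the coupling of \<open>u\<close> and
  \<open>v\<close> to the square of \<open>u - v\<close>.\<close>

lemma crank_nicolson_pointwise:
  fixes w g u0 u1 v0 v1 :: "real^2" and c \<tau> d p0 p1 q0 q1 :: real
  defines "p \<equiv> (p1 + p0) / 2" and "q \<equiv> (q1 + q0) / 2"
    and "u \<equiv> (u1 + u0) /\<^sub>R 2" and "v \<equiv> (v1 + v0) /\<^sub>R 2"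
  assumes \<tau>: "\<tau> \<noteq> 0" and w: "\<And>i. w $ i \<ge> 0"
    and p: "(p1 - p0) / \<tau> = q - acoef w * p"
    and q: "(q1 - q0) / \<tau> = - bcoef w * p + c * d"
    and u: "(u1 - u0) /\<^sub>R \<tau> = c *\<^sub>R g - 2 *\<^sub>R (Gamma1 w *v u) + Gamma1 w *v v"
    and v: "(v1 - v0) /\<^sub>R \<tau> = - (Gamma1_tilde w *v v) + Gamma2 w *v u"
  shows "(energy_density w p1 q1 u1 v1 - energy_density w p0 q0 u0 v0) / \<tau> =
    c * (q * d + g \<bullet> u) - dissipation_density w p u v"
proof -
  define dp dq where "dp = (p1 - p0) / \<tau>" and "dq = (q1 - q0) / \<tau>"
  define du dv where "du = (u1 - u0) /\<^sub>R \<tau>" and "dv = (v1 - v0) /\<^sub>R \<tau>"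
  \<comment> \<open>Discrete chain rule for squares: with the average as test value it is exact,
    without a remainder in \<open>\<tau>\<close>.\<close>
  have sq: "(s\<^sup>2 - t\<^sup>2) / (2 * \<tau>) = (s - t) / \<tau> * ((s + t) / 2)" for s t :: real
    by (simp add: power2_eq_square square_diff_square_factored mult.commute)
  have comp: "((s - t) /\<^sub>R \<tau>) $ i = (s $ i - t $ i) / \<tau>" "((s + t) /\<^sub>R 2) $ i = (s $ i + t $ i) / 2"
    for s t :: "real^2" and i
    by (simp_all add: inverse_eq_divide)
  have "(energy_density w p1 q1 u1 v1 - energy_density w p0 q0 u0 v0) / \<tau> =
    (q1\<^sup>2 - q0\<^sup>2) / (2 * \<tau>)
    + ((u1 $ 1)\<^sup>2 - (u0 $ 1)\<^sup>2) / (2 * \<tau>) + ((u1 $ 2)\<^sup>2 - (u0 $ 2)\<^sup>2) / (2 * \<tau>)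
    + bcoef w * ((p1\<^sup>2 - p0\<^sup>2) / (2 * \<tau>))
    + ratio w 1 * (((v1 $ 1)\<^sup>2 - (v0 $ 1)\<^sup>2) / (2 * \<tau>))
    + ratio w 2 * (((v1 $ 2)\<^sup>2 - (v0 $ 2)\<^sup>2) / (2 * \<tau>))"
    by (simp add: energy_density_def inner_vec2 power2_eq_square diff_divide_distrib
        add_divide_distrib algebra_simps)
  also have "\<dots> = dq * q + du $ 1 * u $ 1 + du $ 2 * u $ 2 + bcoef w * (dp * p)
    + ratio w 1 * (dv $ 1 * v $ 1) + ratio w 2 * (dv $ 2 * v $ 2)" (is "_ = ?L")
    by (simp only: sq comp dp_def dq_def du_def dv_def assms(1-4) mult.assoc add.assoc)
  also have "?L = c * (q * d + g \<bullet> u) - dissipation_density w p u v" (is "_ = ?R")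
  proof -
    have 1: "dp = q - acoef w * p" "dq = - bcoef w * p + c * d"
      using p q by (simp_all add: dp_def dq_def)
    have 2: "du $ 1 = c * g $ 1 - 2 * (w $ 1 * u $ 1) + w $ 1 * v $ 1"
      "du $ 2 = c * g $ 2 - 2 * (w $ 2 * u $ 2) + w $ 2 * v $ 2"
      using u by (simp_all add: du_def diag2_simps)
    have 3: "dv $ 1 = - (w $ 2 * v $ 1) + (w $ 2 - w $ 1) * u $ 1"
      "dv $ 2 = - (w $ 1 * v $ 2) + (w $ 1 - w $ 2) * u $ 2"
      using v by (simp_all add: dv_def diag2_simps)
    \<comment> \<open>The defect is a combination of terms that vanish by the relations for
      \<open>ratio\<close>. The first two come from replacing \<open>w $ i\<close>; the last one
      trades the weight \<open>ratio w 2 * w $ 1\<close> of the second component for the common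
      weight \<open>ratio w 1 * w $ 2\<close>.\<close>
    have "?L - ?R =
        (ratio w 1 * (w $ 1 + w $ 2) - w $ 1) * ((u $ 1)\<^sup>2 - u $ 1 * v $ 1)
        + (ratio w 2 * (w $ 1 + w $ 2) - w $ 2) * ((u $ 2)\<^sup>2 - u $ 2 * v $ 2)
        + (ratio w 1 * w $ 2 - ratio w 2 * w $ 1) * (u $ 2 - v $ 2)\<^sup>2"
      unfolding 1 2 3 dissipation_density_def inner_vec2 acoef_def bcoef_def
        vector_minus_component
      by (simp add: algebra_simps power2_eq_square)
    then show ?thesis
      by (simp add: ratio_mult_acoef w ratio_swap)
  qed
  finally show ?thesis .
qed

section \<open>Energy and dissipation as integrals of densities\<close>

text \<open>Continuity of \<open>w\<close> and Borel measurability of \<open>inverse\<close> make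
  the product measurable, and \<open>abs_ratio_le_1\<close> makes \<open>h\<close> a dominating
  function.\<close>

lemma set_integrable_ratio_mult:
  assumes U: "U \<in> sets borel" and w: "continuous_on UNIV w" "\<And>x i. w x $ i \<ge> 0"
    and h: "set_integrable lborel U h"
  shows "set_integrable lborel U (\<lambda>x. ratio (w x) i * h x)"
proof (rule set_integrable_bound[OF h])
  have [measurable]: "(\<lambda>x. w x $ j) \<in> borel_measurable borel" for j
    using w(1) by (intro borel_measurable_continuous_onI continuous_intros)
  have [measurable]: "(\<lambda>x. indicator U x *\<^sub>R h x) \<in> borel_measurable borel"
    using h by (auto simp: set_integrable_def dest: borel_measurable_integrable)
  have "(\<lambda>x. ratio (w x) i * (indicator U x *\<^sub>R h x)) \<in> borel_measurable borel"
    unfolding ratio_def acoef_def by measurable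
  then show "set_borel_measurable lborel U (\<lambda>x. ratio (w x) i * h x)"
    by (simp add: set_borel_measurable_def mult.left_commute)
  show "AE x in lborel. x \<in> U \<longrightarrow> norm (ratio (w x) i * h x) \<le> norm (h x)"
    using abs_ratio_le_1[OF w(2)] by (auto simp: abs_mult intro!: mult_left_le_one_le)
qed

context
  fixes U :: "(real^2) set" and w :: "real^2 \<Rightarrow> real^2"
  assumes U: "open U" "bounded U" and w: "continuous_on UNIV w" "\<And>x i. w x $ i \<ge> 0"
begin

lemma integrable_continuous:
  fixes h :: "real^2 \<Rightarrow> real"
  assumes "continuous_on (closure U) h"
  shows "set_integrable lborel U h"
  using assms U closure_subset
  by (intro set_integrable_continuous_on_superset[of "closure U"]) (auto simp: compact_closure)

lemma integrable_ratio:
  assumes "continuous_on (closure U) h"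
  shows "set_integrable lborel U (\<lambda>x. ratio (w x) i * h x)"
  using U w assms by (intro set_integrable_ratio_mult integrable_continuous) auto

lemma w_continuous: "continuous_on S w"
  using w(1) continuous_on_subset by blast

lemma
  assumes "continuous_on (closure U) p" "continuous_on (closure U) q"
    "continuous_on (closure U) u" "continuous_on (closure U) v"
  shows energy_density_integrable:
      "set_integrable lborel U (\<lambda>x. energy_density (w x) (p x) (q x) (u x) (v x))"
    and energy_eq_integral:
      "energy U w p q u v = (LINT x:U|lborel. energy_density (w x) (p x) (q x) (u x) (v x))"
proof -
  note [continuous_intros] = w_continuous
  have q: "set_integrable lborel U (\<lambda>x. (q x)\<^sup>2)"
    and u: "set_integrable lborel U (\<lambda>x. u x \<bullet> u x)"
    and p: "set_integrable lborel U (\<lambda>x. bcoef (w x) * (p x)\<^sup>2)"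
    unfolding bcoef_def using assms by (auto intro!: integrable_continuous continuous_intros)
  have v: "set_integrable lborel U (\<lambda>x. ratio (w x) i * (v x $ i)\<^sup>2)" for i
    using assms by (intro integrable_ratio continuous_intros)
  \<comment> \<open>The first fact is integrability of the full sum, the others split its integral.
    The two \<open>ratio\<close> terms stay together because they form the single matrix norm of
    \<open>v\<close>.\<close>
  note sums = set_integral_add[OF set_integral_add(1)[OF set_integral_add(1)[OF q u] p]
      set_integral_add(1)[OF v v], of 1 2]
    set_integral_add(2)[OF set_integral_add(1)[OF q u] p] set_integral_add(2)[OF q u]
  show "set_integrable lborel U (\<lambda>x. energy_density (w x) (p x) (q x) (u x) (v x))"
    unfolding energy_density_def using sums(1) by (intro set_integrable_divide) auto
  \<comment> \<open>A nonnegative integrand has a nonnegative integral, by the default value 0 even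
    if it is not integrable, so squaring undoes the square root.\<close>
  have norm: "(L2_norm U f)\<^sup>2 = (LINT x:U|lborel. f x \<bullet> f x)" for f :: "real^2 \<Rightarrow> 'b::euclidean_space"
    unfolding L2_norm_def L2_inner_def
    by (intro real_sqrt_pow2) (auto simp: set_lebesgue_integral_def intro!: Bochner_Integration.integral_nonneg)
  have "mwnorm2 U (\<lambda>x. inverse (acoef (w x)) *\<^sub>R Gamma1 (w x)) v =
      (LINT x:U|lborel. ratio (w x) 1 * (v x $ 1)\<^sup>2 + ratio (w x) 2 * (v x $ 2)\<^sup>2)"
    unfolding mwnorm2_def L2_inner_def
    by (simp add: diag2_simps inner_vec2 ratio_def power2_eq_square mult.assoc)
  then show "energy U w p q u v = (LINT x:U|lborel. energy_density (w x) (p x) (q x) (u x) (v x))"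
    unfolding energy_density_def energy_def norm set_integral_divide_zero sums(2-)
    by (simp add: wnorm2_def L2_inner_def power2_eq_square mult.assoc)
qed

lemma
  fixes p :: "nat \<Rightarrow> real^2 \<Rightarrow> real" and u v :: "nat \<Rightarrow> real^2 \<Rightarrow> real^2"
  defines "P \<equiv> \<lambda>n x. At (\<lambda>m. p m x) n" and "X \<equiv> \<lambda>n x. At (\<lambda>m. u m x) n"
    and "Y \<equiv> \<lambda>n x. At (\<lambda>m. v m x) n"
  assumes "continuous_on (closure U) (P n)" "continuous_on (closure U) (X n)"
    "continuous_on (closure U) (Y n)"
  shows dissipation_density_integrable:
      "set_integrable lborel U (\<lambda>x. dissipation_density (w x) (P n x) (X n x) (Y n x))"
    and dissipation_eq_integral:
      "dissipation U w p u v n =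
        (LINT x:U|lborel. dissipation_density (w x) (P n x) (X n x) (Y n x))"
proof -
  note [continuous_intros] = w_continuous
  have p: "set_integrable lborel U (\<lambda>x. acoef (w x) * bcoef (w x) * (P n x)\<^sup>2)"
    and u: "set_integrable lborel U (\<lambda>x. w x $ 1 * (X n x $ 1)\<^sup>2 + w x $ 2 * (X n x $ 2)\<^sup>2)"
    unfolding acoef_def bcoef_def using assms(4-)
    by (auto intro!: integrable_continuous continuous_intros)
  have u': "set_integrable lborel U (\<lambda>x. ratio (w x) i * (w x $ i * (X n x $ i)\<^sup>2))" for i
    using assms(4-) by (intro integrable_ratio continuous_intros)
  have uv: "set_integrable lborel U
      (\<lambda>x. ratio (w x) 1 * (w x $ 2 * ((X n x - Y n x) \<bullet> (X n x - Y n x))))"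
    using assms(4-) by (intro integrable_ratio continuous_intros)
  \<comment> \<open>All terms of the matrix norm of \<open>X n\<close> are gathered in one function,
    since \<open>dissipation\<close> holds them in one integral.\<close>
  note u'' = set_integral_add(1)[OF set_integral_add(1)[OF u u'] u', of 1 2]
  note sums = set_integral_add[OF set_integral_add(1)[OF p u''] uv] set_integral_add(2)[OF p u'']
  show "set_integrable lborel U (\<lambda>x. dissipation_density (w x) (P n x) (X n x) (Y n x))"
    unfolding dissipation_density_def by (rule sums(1))
  have "At (\<lambda>m. u m x - v m x) n = X n x - Y n x" for x
    by (simp add: X_def Y_def At_def algebra_simps)
  moreover have "mwnorm2 U (\<lambda>x. Gamma1 (w x) + inverse (acoef (w x)) *\<^sub>R (Gamma1 (w x) ** Gamma1 (w x))) (X n) =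
      (LINT x:U|lborel. w x $ 1 * (X n x $ 1)\<^sup>2 + w x $ 2 * (X n x $ 2)\<^sup>2
        + ratio (w x) 1 * (w x $ 1 * (X n x $ 1)\<^sup>2) + ratio (w x) 2 * (w x $ 2 * (X n x $ 2)\<^sup>2))"
    unfolding mwnorm2_def L2_inner_def
    by (simp add: diag2_simps inner_vec2 ratio_def power2_eq_square algebra_simps)
  moreover have "dissipation U w p u v n = wnorm2 U (\<lambda>x. acoef (w x) * bcoef (w x)) (P n)
      + mwnorm2 U (\<lambda>x. Gamma1 (w x) + inverse (acoef (w x)) *\<^sub>R (Gamma1 (w x) ** Gamma1 (w x))) (X n)
      + wnorm2 U (\<lambda>x. inverse (acoef (w x)) * bcoef (w x)) (\<lambda>x. At (\<lambda>m. u m x - v m x) n)"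
    by (simp add: dissipation_def P_def X_def)
  ultimately show "dissipation U w p u v n =
      (LINT x:U|lborel. dissipation_density (w x) (P n x) (X n x) (Y n x))"
    unfolding dissipation_density_def sums(2-)
    by (simp add: wnorm2_def L2_inner_def power2_eq_square ratio_def bcoef_def mult.assoc)
qed

end

section \<open>The discrete energy law\<close>

theorem theorem3p1:
  fixes a L xb :: "real^2"
    and D U :: "(real^2) set"
    and c \<tau> :: real
    and w :: "real^2 \<Rightarrow> real^2"
    and p q :: "nat \<Rightarrow> real^2 \<Rightarrow> real"
    and chi lam :: "nat \<Rightarrow> real^2 \<Rightarrow> real^2"
  assumes a_pos: "\<And>i. a $ i > 0"
    and L_pos: "\<And>i. L $ i > 0"
    and xb_nonneg: "\<And>i. xb $ i \<ge> 0"
    and D_smooth: "smooth_open_set D"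
    and D_bounded: "bounded D"
    and D_inside: "closure D \<subseteq> Omega_phy a"
    and U_eq: "U = Omega a L - closure D"
    and w_eq: "w = xi a L xb"
    and c_pos: "c > 0"
    and tau_pos: "\<tau> > 0"
    and p_smooth: "\<And>n. C1_closure U (p n)"
    and q_smooth: "\<And>n. C1_closure U (q n)"
    and chi_smooth: "\<And>n. C1_closure U (chi n)"
    and lam_smooth: "\<And>n. C1_closure U (lam n)"
    and p_bc_D: "\<And>n x. x \<in> frontier D \<Longrightarrow> p n x = 0"
    and p_bc_Omega: "\<And>n x. x \<in> frontier (Omega a L) \<Longrightarrow> p n x = 0"
    and lam_bc: "\<And>n x. x \<in> Omega_sides a L \<Longrightarrow> lam n x \<bullet> outer_normal a L x = 0"
    and eq_p: "\<And>n x. x \<in> U \<Longrightarrow>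
      Dt \<tau> (\<lambda>m. p m x) n = At (\<lambda>m. q m x) n - acoef (w x) * At (\<lambda>m. p m x) n"
    and eq_q: "\<And>n x. x \<in> U \<Longrightarrow>
      Dt \<tau> (\<lambda>m. q m x) n =
        - bcoef (w x) * At (\<lambda>m. p m x) n + c * divergence (\<lambda>y. At (\<lambda>m. chi m y) n) x"
    and eq_chi: "\<And>n x. x \<in> U \<Longrightarrow>
      Dt \<tau> (\<lambda>m. chi m x) n =
        c *\<^sub>R grad (\<lambda>y. At (\<lambda>m. q m y) n) x
        - 2 *\<^sub>R (Gamma1 (w x) *v At (\<lambda>m. chi m x) n)
        + Gamma1 (w x) *v At (\<lambda>m. lam m x) n"
    and eq_lam: "\<And>n x. x \<in> U \<Longrightarrow>
      Dt \<tau> (\<lambda>m. lam m x) n =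
        - (Gamma1_tilde (w x) *v At (\<lambda>m. lam m x) n)
        + Gamma2 (w x) *v At (\<lambda>m. chi m x) n"
  shows "\<forall>n. Dt \<tau> (\<lambda>m. energy U w (p m) (q m) (chi m) (lam m)) n
             = - dissipation U w p chi lam n"
proof
  fix n
  let ?P = "\<lambda>x. At (\<lambda>m. p m x) n" and ?Q = "\<lambda>x. At (\<lambda>m. q m x) n"
  let ?X = "\<lambda>x. At (\<lambda>m. chi m x) n" and ?Y = "\<lambda>x. At (\<lambda>m. lam m x) n"
  let ?E = "\<lambda>n x. energy_density (w x) (p n x) (q n x) (chi n x) (lam n x)"
  let ?D = "\<lambda>x. dissipation_density (w x) (?P x) (?X x) (?Y x)"
  have U: "open U" "bounded U"
    unfolding U_eq Omega_def by (auto intro: bounded_subset[OF bounded_box])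
  have w: "continuous_on S w" "w x $ i \<ge> 0" for S x i
    unfolding w_eq using L_pos xb_nonneg by (simp_all add: continuous_xi) (simp add: xi_def damping_nonneg)
  have smooth: "C1_closure U ?P" "C1_closure U ?Q" "C1_closure U ?X" "C1_closure U ?Y"
    using p_smooth q_smooth chi_smooth lam_smooth by (auto intro: C1_closure_At)
  have cont: "continuous_on (closure U) f" if "C1_closure U f" for f :: "real^2 \<Rightarrow> 'b::real_normed_vector"
    using that by (simp add: C1_closure_def)
  note conts = p_smooth[THEN cont] q_smooth[THEN cont] chi_smooth[THEN cont] lam_smooth[THEN cont]
    smooth[THEN cont]
  have intE: "set_integrable lborel U (?E m)" for m
    using U w conts by (intro energy_density_integrable) auto
  have intD: "set_integrable lborel U ?D"
    using U w conts by (intro dissipation_density_integrable) auto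
  have Q_bc: "?Q x = 0" if "x \<in> frontier U" for x
  proof -
    have "frontier U \<subseteq> frontier (Omega a L) \<union> frontier (- closure D)"
      unfolding U_eq Diff_eq by (rule frontier_Int_subset)
    \<comment> \<open>The left side is \<open>closure D\<close> without the interior of
      \<open>closure D\<close>, and that interior contains \<open>interior D\<close>.\<close>
    also have "frontier (- closure D) \<subseteq> frontier D"
      using interior_mono[OF closure_subset[of D]] by (auto simp: frontier_def closure_complement interior_complement)
    finally have "p m x = 0" for m
      using that p_bc_D p_bc_Omega by blast
    then have P0: "Dt \<tau> (\<lambda>m. p m x) n = 0" "?P x = 0"
      by (simp_all add: Dt_def At_def)
    \<comment> \<open>The residual of the first equation of the scheme, which is given only inside
      \<open>U\<close>. It extends continuously to the closure, so it vanishes on the frontier as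
      well; with \<open>P0\<close> only \<open>?Q x\<close> remains of it there.\<close>
    let ?r = "\<lambda>x. ?Q x - acoef (w x) * ?P x - Dt \<tau> (\<lambda>m. p m x) n"
    have "?r x = 0"
    proof (rule continuous_constant_on_closure[of U ?r])
      show "continuous_on (closure U) ?r"
        unfolding acoef_def Dt_def using w conts by (intro continuous_intros)
      show "x \<in> closure U"
        using that by (simp add: frontier_def)
    qed (use eq_p in simp)
    then show ?thesis
      using P0 by simp
  qed
  have "Dt \<tau> (\<lambda>m. energy U w (p m) (q m) (chi m) (lam m)) n
      = ((LINT x:U|lborel. ?E (n + 1) x) - (LINT x:U|lborel. ?E n x)) / \<tau>"
    using U w conts by (simp add: Dt_def energy_eq_integral inverse_eq_divide)
  also have "\<dots> = (LINT x:U|lborel. (?E (n + 1) x - ?E n x) / \<tau>)"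
    using intE by simp
  also have "\<dots> = (LINT x:U|lborel. c * (?Q x * divergence ?X x + grad ?Q x \<bullet> ?X x) - ?D x)"
  proof (rule set_lebesgue_integral_cong)
    have "(?E (n + 1) x - ?E n x) / \<tau> = c * (?Q x * divergence ?X x + grad ?Q x \<bullet> ?X x) - ?D x"
      if "x \<in> U" for x
      using crank_nicolson_pointwise[of \<tau> "w x" "p (n + 1) x" "p n x" "q (n + 1) x" "q n x" c
          "divergence ?X x" "chi (n + 1) x" "chi n x" "grad ?Q x" "lam (n + 1) x" "lam n x"]
        tau_pos w(2) eq_p[OF that, of n] eq_q[OF that, of n] eq_chi[OF that, of n] eq_lam[OF that, of n]
      by (simp add: Dt_def At_def inverse_eq_divide)
    then show "\<forall>x. x \<in> U \<longrightarrow>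
        (?E (n + 1) x - ?E n x) / \<tau> = c * (?Q x * divergence ?X x + grad ?Q x \<bullet> ?X x) - ?D x"
      by blast
  qed (use U in simp)
  also have "\<dots> = c * (LINT x:U|lborel. ?Q x * divergence ?X x + grad ?Q x \<bullet> ?X x)
      - (LINT x:U|lborel. ?D x)"
    using divergence_product_integrable[OF U smooth(2) Q_bc smooth(3)] intD by simp
  also have "\<dots> = - dissipation U w p chi lam n"
    using integral_divergence_product_eq_0[OF U smooth(2) Q_bc smooth(3)]
      dissipation_eq_integral[OF U w conts(5,7,8)] by simp
  finally show "Dt \<tau> (\<lambda>m. energy U w (p m) (q m) (chi m) (lam m)) n
      = - dissipation U w p chi lam n" .
qed

end
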